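(* Let $0<\mu\le L$ and $f\in\mathcal S^1_{\mu,L}$. Let $s>0$, $q=\mu s$, and let $\eta,\nu,\tau$ be real numbers such that $0\le\eta s\le1/L$, $\nu\ge0$, $1-\nu\sqrt q>0$, $\tau>0$ and $\zeta:=1+(1-\tau)\sqrt q\ge0$. Then the iterates of algorithm $(\mathcal A)$ (defined in the context) satisfy, for every $k\ge1$, $$\Big(\frac{\zeta\nu}{\tau^2}(\tau+\zeta\eta\sqrt q)+\frac{\nu\sqrt q}{1-\nu\sqrt q}\Big)(f(x_k)-f^* )-\frac{\nu s}{2}\Big(\frac{\nu}{1-\nu\sqrt q}-\frac{\zeta\eta}{\tau}\Big)\|\nabla f(x_k)\|^2+\frac{1}{1-\nu\sqrt q}\,\frac\mu2\|z_{k+1}-x^*\|^2$$ $$\le\frac{\zeta\nu}{\tau^2}(\tau+\zeta\eta\sqrt q)\Big(f(x_{k-1})-f^*-\frac{\eta s}{2}\|\nabla f(x_{k-1})\|^2\Big)+\frac\mu2\|z_k-x^*\|^2.$$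
   Context: For $0<\mu\le L$, $\mathcal S^1_{\mu,L}$ is the set of continuously differentiable convex functions $f:\mathbb R^n\to\mathbb R$ that are $L$-smooth ($\|\nabla f(y)-\nabla f(x)\|\le L\|y-x\|$ for all $x,y$) and $\mu$-strongly convex ($f(y)\ge f(x)+\langle\nabla f(x),y-x\rangle+\frac{\mu}{2}\|y-x\|^2$ for all $x,y$); $\|\cdot\|$ is the Euclidean norm. $x^*$ is the unique minimizer of $f$ and $f^*=f(x^* )$. Algorithm $(\mathcal A)$ with parameters $\eta,\nu,\tau\ge0$: starting from $x_0=z_0\in\mathbb R^n$, for $k\ge0$, $$y_{k+1}=x_k-\eta s\nabla f(x_k),$$ $$z_{k+1}=\nu\sqrt q\,\Big(x_k-\frac1\mu\nabla f(x_k)\Big)+(1-\nu\sqrt q)z_k,$$ $$x_{k+1}=\frac{\tau\sqrt q}{1+\sqrt q}z_{k+1}+\Big(1-\frac{\tau\sqrt q}{1+\sqrt q}\Big)y_{k+1}.$$ *)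

theory Defs
  imports "HOL-Analysis.Analysis"
begin

definition gradient :: "('a::real_inner \<Rightarrow> real) \<Rightarrow> 'a \<Rightarrow> 'a"
  where "gradient f x = (THE D. GDERIV f x :> D)"

definition smooth_strongly_convex :: "real \<Rightarrow> real \<Rightarrow> (real ^ 'n \<Rightarrow> real) set"
  where "smooth_strongly_convex \<mu> L =
    {f. (\<forall>x. f differentiable (at x)) \<and> continuous_on UNIV (gradient f) \<and>
        convex_on UNIV f \<and>
        (\<forall>x y. norm (gradient f y - gradient f x) \<le> L * norm (y - x)) \<and>
        (\<forall>x y. f y \<ge> f x + gradient f x \<bullet> (y - x) + \<mu> / 2 * (norm (y - x))\<^sup>2)}"

definition minimizer :: "('a \<Rightarrow> real) \<Rightarrow> 'a"
  where "minimizer f = (THE x. \<forall>y. f x \<le> f y)"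

(* The value y 0 is unconstrained: the algorithm only produces y (Suc k). *)
definition algorithm_A ::
  "real \<Rightarrow> real \<Rightarrow> real \<Rightarrow> real \<Rightarrow> real \<Rightarrow> real \<Rightarrow> ('a::real_inner \<Rightarrow> real) \<Rightarrow>
    (nat \<Rightarrow> 'a) \<Rightarrow> (nat \<Rightarrow> 'a) \<Rightarrow> (nat \<Rightarrow> 'a) \<Rightarrow> bool"
  where "algorithm_A \<mu> s q \<eta> \<nu> \<tau> f x y z \<longleftrightarrow>
    x 0 = z 0 \<and>
    (\<forall>k. y (Suc k) = x k - (\<eta> * s) *\<^sub>R gradient f (x k) \<and>
         z (Suc k) = (\<nu> * sqrt q) *\<^sub>R (x k - (1 / \<mu>) *\<^sub>R gradient f (x k))
                       + (1 - \<nu> * sqrt q) *\<^sub>R z k \<and>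
         x (Suc k) = (\<tau> * sqrt q / (1 + sqrt q)) *\<^sub>R z (Suc k)
                       + (1 - \<tau> * sqrt q / (1 + sqrt q)) *\<^sub>R y (Suc k))"

text \<open>The definite descriptions above denote what they should:\<close>

lemma gradient_eqI:
  assumes "GDERIV f x :> D"
  shows "gradient f x = D"
  unfolding gradient_def
proof (rule the_equality[where P = "\<lambda>D. GDERIV f x :> D", OF assms])
  fix D' assume "GDERIV f x :> D'"
  with assms have "(\<lambda>h. h \<bullet> D') = (\<lambda>h. h \<bullet> D)"
    unfolding gderiv_def by (rule has_derivative_unique[rotated])
  then have "h \<bullet> D' = h \<bullet> D" for h by metis
  then show "D' = D"
    by (metis inner_commute vector_eq_rdot)
qed

lemma GDERIV_gradient:
  fixes f :: "'a::euclidean_space \<Rightarrow> real"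
  assumes "f differentiable (at x)"
  shows "GDERIV f x :> gradient f x"
proof -
  from assms obtain f' where f': "(f has_derivative f') (at x)"
    unfolding differentiable_def by blast
  then interpret linear f' by (rule has_derivative_linear)
  have "f' = (\<lambda>h. h \<bullet> (\<Sum>b\<in>Basis. f' b *\<^sub>R b))"
  proof
    fix h
    have "f' h = f' (\<Sum>b\<in>Basis. (h \<bullet> b) *\<^sub>R b)"
      by (simp add: euclidean_representation)
    also have "\<dots> = h \<bullet> (\<Sum>b\<in>Basis. f' b *\<^sub>R b)"
      by (simp add: sum scale inner_sum_right mult.commute)
    finally show "f' h = h \<bullet> (\<Sum>b\<in>Basis. f' b *\<^sub>R b)" .
  qed
  with f' have "GDERIV f x :> (\<Sum>b\<in>Basis. f' b *\<^sub>R b)"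
    unfolding gderiv_def by simp
  then show ?thesis using gradient_eqI by metis
qed

lemma ex1_minimizer:
  fixes f :: "real ^ 'n \<Rightarrow> real"
  assumes "0 < \<mu>" and "f \<in> smooth_strongly_convex \<mu> L"
  shows "\<exists>!x. \<forall>y. f x \<le> f y"
proof -
  have diff: "f differentiable (at x)" for x
    using assms(2) by (simp add: smooth_strongly_convex_def)
  have sc: "f y \<ge> f x + gradient f x \<bullet> (y - x) + \<mu> / 2 * (norm (y - x))\<^sup>2" for x y
    using assms(2) by (simp add: smooth_strongly_convex_def)
  have cont: "continuous_on S f" for S
    by (meson diff continuous_at_imp_continuous_on differentiable_imp_continuous_within)
  define R where "R = 2 * norm (gradient f 0) / \<mu>"
  have "0 \<le> R" using assms(1) by (simp add: R_def)
  then obtain x where x: "x \<in> cball 0 R" "\<And>y. y \<in> cball 0 R \<Longrightarrow> f x \<le> f y"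
    using continuous_attains_inf[OF compact_cball _ cont, of 0 R] by auto
  have ex: "f x \<le> f y" for y
  proof (cases "y \<in> cball 0 R")
    case True then show ?thesis by (rule x(2))
  next
    case False
    then have "R \<le> norm y" by simp
    then have "norm (gradient f 0) \<le> \<mu> / 2 * norm y"
      using assms(1) by (simp add: R_def field_simps)
    then have "norm (gradient f 0) * norm y \<le> \<mu> / 2 * norm y * norm y"
      by (rule mult_right_mono) simp
    moreover have "- (norm (gradient f 0) * norm y) \<le> gradient f 0 \<bullet> y"
      using Cauchy_Schwarz_ineq2[of "gradient f 0" y] by linarith
    ultimately have "f 0 \<le> f y"
      using sc[of 0 y] by (simp add: power2_eq_square)
    moreover have "f x \<le> f 0" using \<open>0 \<le> R\<close> by (intro x(2)) simp
    ultimately show ?thesis by linarith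
  qed
  moreover have "a = b" if a: "\<forall>y. f a \<le> f y" and b: "\<forall>y. f b \<le> f y" for a b
  proof -
    define m where "m = (1 / 2) *\<^sub>R (a + b)"
    have am: "a - m = (1 / 2) *\<^sub>R (a - b)" and bm: "b - m = - ((1 / 2) *\<^sub>R (a - b))"
      by (simp_all add: m_def vec_eq_iff field_simps)
    have "f a + f b \<ge> 2 * f m + \<mu> * (norm ((1 / 2) *\<^sub>R (a - b)))\<^sup>2"
      using sc[of m a] sc[of m b] unfolding am bm inner_minus_right norm_minus_cancel
      by (simp add: algebra_simps)
    moreover have "f a \<le> f m" "f b \<le> f m" using a b by auto
    ultimately have "\<mu> * (norm ((1 / 2) *\<^sub>R (a - b)))\<^sup>2 \<le> 0" by linarith
    then show "a = b" using assms(1) by (simp add: mult_le_0_iff)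
  qed
  ultimately show ?thesis by blast
qed

end

theory Submission
  imports Defs
begin

text \<open>Since \<open>z\<^sub>k\<^sub>+\<^sub>1 - x\<^sup>*\<close> is a convex combination of \<open>x\<^sub>k - x\<^sup>* - \<nabla>f(x\<^sub>k)/\<mu>\<close> and
  \<open>z\<^sub>k - x\<^sup>*\<close>, its squared norm expands exactly; strong convexity between \<open>x\<^sub>k\<close> and \<open>x\<^sup>*\<close>
  bounds one term of the expansion, and \<open>x\<^sub>k - z\<^sub>k\<close> is a multiple of \<open>y\<^sub>k - x\<^sub>k\<close>. What remains
  follows from the interpolation inequality
  \<open>f(w) \<ge> f(x) + \<langle>\<nabla>f(x), w - x\<rangle> + \<parallel>\<nabla>f(w) - \<nabla>f(x)\<parallel>\<^sup>2/(2L)\<close> between \<open>x\<^sub>k\<close> and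
  \<open>x\<^sub>k\<^sub>-\<^sub>1\<close>, which leaves the slack \<open>\<parallel>y\<^sub>k - x\<^sub>k + \<eta>s \<nabla>f(x\<^sub>k)\<parallel>\<^sup>2\<close>.\<close>

lemma lipschitz_gradient_upper_bound:
  fixes f :: "'a::real_inner \<Rightarrow> real"
  assumes grad: "\<And>x. GDERIV f x :> g x"
    and lip: "\<And>x y. norm (g y - g x) \<le> L * norm (y - x)"
  shows "f y \<le> f x + g x \<bullet> (y - x) + L / 2 * (norm (y - x))\<^sup>2"
proof -
  define d where "d = y - x"
  define \<phi> where "\<phi> t = f (x + t *\<^sub>R d) - t * (g x \<bullet> d) - L / 2 * t\<^sup>2 * (norm d)\<^sup>2" for t
  have f_line: "((\<lambda>t. f (x + t *\<^sub>R d)) has_real_derivative g (x + t *\<^sub>R d) \<bullet> d) (at t)" for t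
  proof -
    have "((\<lambda>t. x + t *\<^sub>R d) has_derivative (\<lambda>h. h *\<^sub>R d)) (at t)"
      by (auto intro!: derivative_eq_intros)
    from has_derivative_compose[OF this grad[unfolded gderiv_def]] show ?thesis
      by (simp add: has_field_derivative_def inner_commute mult_commute_abs)
  qed
  have \<phi>: "(\<phi> has_real_derivative (g (x + t *\<^sub>R d) - g x) \<bullet> d - L * t * (norm d)\<^sup>2) (at t)" for t
    unfolding \<phi>_def by (rule derivative_eq_intros f_line refl)+ (simp add: inner_diff_left)
  have "(g (x + t *\<^sub>R d) - g x) \<bullet> d - L * t * (norm d)\<^sup>2 \<le> 0" if "0 \<le> t" for t
  proof -
    have "(g (x + t *\<^sub>R d) - g x) \<bullet> d \<le> norm (g (x + t *\<^sub>R d) - g x) * norm d"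
      by (rule norm_cauchy_schwarz)
    also have "\<dots> \<le> (L * norm (t *\<^sub>R d)) * norm d"
      using lip[of "x + t *\<^sub>R d" x] by (intro mult_right_mono) auto
    finally show ?thesis
      using that by (simp add: power2_eq_square mult.assoc)
  qed
  then have "\<phi> 1 \<le> \<phi> 0"
    by (intro DERIV_nonpos_imp_nonincreasing[OF zero_le_one]) (use \<phi> in blast)
  then show ?thesis
    by (simp add: \<phi>_def d_def)
qed

lemma smooth_convex_interpolation:
  fixes f :: "'a::real_inner \<Rightarrow> real"
  assumes "0 < L"
    and grad: "\<And>x. GDERIV f x :> g x"
    and lip: "\<And>x y. norm (g y - g x) \<le> L * norm (y - x)"
    and convex: "\<And>x y. f y \<ge> f x + g x \<bullet> (y - x)"
  shows "f y \<ge> f x + g x \<bullet> (y - x) + 1 / (2 * L) * (norm (g y - g x))\<^sup>2"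
proof -
  define D where "D = g y - g x"
  \<comment> \<open>the minimizer of the quadratic upper model at \<open>y\<close> of \<open>f - g x \<bullet> _\<close>\<close>
  define u where "u = y - (1 / L) *\<^sub>R D"
  have "f x + g x \<bullet> (u - x) \<le> f u"
    by (rule convex)
  also have "\<dots> \<le> f y + g y \<bullet> (u - y) + L / 2 * (norm (u - y))\<^sup>2"
    by (rule lipschitz_gradient_upper_bound[OF grad lip])
  also have "norm (u - y) = norm ((1 / L) *\<^sub>R D)"
    by (simp add: u_def)
  finally have "f x + g x \<bullet> (u - x) - g y \<bullet> (u - y) \<le> f y + L / 2 * (1 / L)\<^sup>2 * (D \<bullet> D)"
    using \<open>0 < L\<close> by (simp add: power_mult_distrib power2_norm_eq_inner power_divide)
  moreover have "g x \<bullet> (u - x) - g y \<bullet> (u - y) = g x \<bullet> (y - x) + D \<bullet> D / L"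
    by (simp add: u_def D_def inner_diff_left inner_diff_right diff_divide_distrib)
  moreover have "D \<bullet> D / L - L / 2 * (1 / L)\<^sup>2 * (D \<bullet> D) = 1 / (2 * L) * (D \<bullet> D)"
    using \<open>0 < L\<close> by (simp add: field_simps power2_eq_square)
  ultimately show ?thesis
    unfolding power2_norm_eq_inner D_def by linarith
qed

lemma norm_affine_combination_sq:
  fixes u v :: "'a::real_inner"
  shows "(norm (a *\<^sub>R u + (1 - a) *\<^sub>R v))\<^sup>2
    = a * (norm u)\<^sup>2 + (1 - a) * (norm v)\<^sup>2 - a * (1 - a) * (norm (u - v))\<^sup>2"
  unfolding power2_norm_eq_inner by (simp add: inner_simps inner_commute algebra_simps)

lemma half_norm_diff_scaled_sq:
  fixes u g :: "'a::real_inner"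
  assumes "\<mu> \<noteq> 0"
  shows "\<mu> / 2 * (norm (u - (1 / \<mu>) *\<^sub>R g))\<^sup>2
    = \<mu> / 2 * (norm u)\<^sup>2 - g \<bullet> u + (norm g)\<^sup>2 / (2 * \<mu>)"
  using assms unfolding power2_norm_eq_inner
  by (simp add: inner_simps inner_commute field_simps power2_eq_square)

lemma momentum_step_bound:
  fixes x x' z g :: "'a::real_inner"
  assumes "0 < \<mu>" "0 \<le> a" "a < 1"
    and strong: "F' \<ge> F + g \<bullet> (x' - x) + \<mu> / 2 * (norm (x' - x))\<^sup>2"
    and Z: "Z = a *\<^sub>R (x - (1 / \<mu>) *\<^sub>R g) + (1 - a) *\<^sub>R z"
  shows "1 / (1 - a) * (\<mu> / 2) * (norm (Z - x'))\<^sup>2 + a / (1 - a) * (F - F')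
    \<le> \<mu> / 2 * (norm (z - x'))\<^sup>2 + a\<^sup>2 / (1 - a) * ((norm g)\<^sup>2 / (2 * \<mu>))
      + a * (g \<bullet> (x - z)) - a * (\<mu> / 2) * (norm (x - z))\<^sup>2"
proof -
  define A where "A = \<mu> / 2 * (norm (x - x' - (1 / \<mu>) *\<^sub>R g))\<^sup>2"
  define B where "B = \<mu> / 2 * (norm (x - z - (1 / \<mu>) *\<^sub>R g))\<^sup>2"
  have "Z - x' = a *\<^sub>R (x - x' - (1 / \<mu>) *\<^sub>R g) + (1 - a) *\<^sub>R (z - x')"
    unfolding Z by (simp add: algebra_simps)
  moreover have "x - x' - (1 / \<mu>) *\<^sub>R g - (z - x') = x - z - (1 / \<mu>) *\<^sub>R g"
    by simp
  moreover have "1 / (1 - a) * (\<mu> / 2) * (a * P + (1 - a) * Q - a * (1 - a) * R)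
      = a / (1 - a) * (\<mu> / 2 * P) + \<mu> / 2 * Q - a * (\<mu> / 2 * R)" for P Q R
    using \<open>a < 1\<close> by (simp add: field_simps)
  ultimately have "1 / (1 - a) * (\<mu> / 2) * (norm (Z - x'))\<^sup>2
      = a / (1 - a) * A + \<mu> / 2 * (norm (z - x'))\<^sup>2 - a * B"
    unfolding A_def B_def by (simp only: norm_affine_combination_sq)
  moreover have "A = \<mu> / 2 * (norm (x - x'))\<^sup>2 - g \<bullet> (x - x') + (norm g)\<^sup>2 / (2 * \<mu>)"
    using \<open>0 < \<mu>\<close> unfolding A_def by (intro half_norm_diff_scaled_sq) simp
  then have "A \<le> F' - F + (norm g)\<^sup>2 / (2 * \<mu>)"
    using strong by (simp add: norm_minus_commute inner_diff_right)
  then have "a / (1 - a) * A \<le> a / (1 - a) * (F' - F + (norm g)\<^sup>2 / (2 * \<mu>))"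
    using \<open>0 \<le> a\<close> \<open>a < 1\<close> by (intro mult_left_mono) auto
  moreover have "B = \<mu> / 2 * (norm (x - z))\<^sup>2 - g \<bullet> (x - z) + (norm g)\<^sup>2 / (2 * \<mu>)"
    using \<open>0 < \<mu>\<close> unfolding B_def by (intro half_norm_diff_scaled_sq) simp
  then have "a * B = a * (\<mu> / 2) * (norm (x - z))\<^sup>2 - a * (g \<bullet> (x - z)) + a * ((norm g)\<^sup>2 / (2 * \<mu>))"
    by (simp add: distrib_left right_diff_distrib)
  moreover have "a\<^sup>2 / (1 - a) = a / (1 - a) - a"
    using \<open>a < 1\<close> by (simp add: field_simps power2_eq_square)
  then have "a\<^sup>2 / (1 - a) * ((norm g)\<^sup>2 / (2 * \<mu>))
      = a / (1 - a) * ((norm g)\<^sup>2 / (2 * \<mu>)) - a * ((norm g)\<^sup>2 / (2 * \<mu>))"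
    by (simp only: left_diff_distrib)
  ultimately show ?thesis
    unfolding distrib_left right_diff_distrib by linarith
qed

lemma gradient_step_bound:
  fixes x w p g :: "'a::real_inner"
  assumes "h \<le> 1 / L" "0 < L"
    and interp: "W \<ge> F + g \<bullet> (w - x) + 1 / (2 * L) * (norm (p - g))\<^sup>2"
    and y: "y = w - h *\<^sub>R p"
  shows "F - W + h / 2 * (norm p)\<^sup>2 \<le> - (g \<bullet> (y - x)) - h / 2 * (norm g)\<^sup>2"
proof -
  have "h / 2 * (norm (p - g))\<^sup>2 \<le> 1 / (2 * L) * (norm (p - g))\<^sup>2"
    using assms(1,2) by (intro mult_right_mono) (auto simp: field_simps)
  then have "F + g \<bullet> (w - x) + h / 2 * (norm (p - g))\<^sup>2 \<le> W"
    using interp by linarith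
  then show ?thesis
    unfolding y power2_norm_eq_inner by (simp add: inner_simps inner_commute algebra_simps)
qed

lemma affine_combination_diff:
  fixes x y z :: "'a::real_vector"
  assumes "\<theta> \<noteq> 0" and "x = \<theta> *\<^sub>R z + (1 - \<theta>) *\<^sub>R y"
  shows "x - z = ((1 - \<theta>) / \<theta>) *\<^sub>R (y - x)"
proof -
  have "\<theta> *\<^sub>R (x - z) = (1 - \<theta>) *\<^sub>R (y - x)"
    using assms(2) by (simp add: algebra_simps)
  then have "(1 / \<theta>) *\<^sub>R \<theta> *\<^sub>R (x - z) = (1 / \<theta>) *\<^sub>R (1 - \<theta>) *\<^sub>R (y - x)"
    by simp
  with assms(1) show ?thesis by simp
qed

theorem lemma2:
  fixes f :: "real ^ 'n \<Rightarrow> real"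
    and x y z :: "nat \<Rightarrow> real ^ 'n"
    and \<mu> L s q \<eta> \<nu> \<tau> \<zeta> fstar :: real
    and xstar :: "real ^ 'n"
    and k :: nat
  defines "xstar \<equiv> minimizer f"
    and "fstar \<equiv> f xstar"
    and "q \<equiv> \<mu> * s"
    and "\<zeta> \<equiv> 1 + (1 - \<tau>) * sqrt q"
  assumes "0 < \<mu>" and "\<mu> \<le> L"
    and "f \<in> smooth_strongly_convex \<mu> L"
    and "s > 0"
    and "0 \<le> \<eta> * s" and "\<eta> * s \<le> 1 / L"
    and "\<nu> \<ge> 0" and "1 - \<nu> * sqrt q > 0"
    and "\<tau> > 0" and "\<zeta> \<ge> 0"
    and "algorithm_A \<mu> s q \<eta> \<nu> \<tau> f x y z"
    and "k \<ge> 1"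
  shows "(\<zeta> * \<nu> / \<tau>\<^sup>2 * (\<tau> + \<zeta> * \<eta> * sqrt q) + \<nu> * sqrt q / (1 - \<nu> * sqrt q))
             * (f (x k) - fstar)
           - \<nu> * s / 2 * (\<nu> / (1 - \<nu> * sqrt q) - \<zeta> * \<eta> / \<tau>) * (norm (gradient f (x k)))\<^sup>2
           + 1 / (1 - \<nu> * sqrt q) * (\<mu> / 2) * (norm (z (k + 1) - xstar))\<^sup>2
         \<le> \<zeta> * \<nu> / \<tau>\<^sup>2 * (\<tau> + \<zeta> * \<eta> * sqrt q)
             * (f (x (k - 1)) - fstar - \<eta> * s / 2 * (norm (gradient f (x (k - 1))))\<^sup>2)
           + \<mu> / 2 * (norm (z k - xstar))\<^sup>2"
proof -
  define r where "r = sqrt q"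
  define a where "a = \<nu> * r"
  define c where "c = \<zeta> / (\<tau> * r)"
  define g where "g = gradient f (x k)"
  define p where "p = gradient f (x (k - 1))"
  define d where "d = y k - x k"
  define C where "C = \<zeta> * \<nu> / \<tau>\<^sup>2 * (\<tau> + \<zeta> * \<eta> * r)"
  have L: "0 < L" using \<open>0 < \<mu>\<close> \<open>\<mu> \<le> L\<close> by simp
  have \<eta>: "0 \<le> \<eta>" using \<open>0 \<le> \<eta> * s\<close> \<open>s > 0\<close> by (simp add: zero_le_mult_iff)
  have r: "0 < r" "r\<^sup>2 = \<mu> * s"
    using \<open>0 < \<mu>\<close> \<open>s > 0\<close> by (simp_all add: r_def q_def)
  have a: "0 \<le> a" "a < 1"
    using \<open>\<nu> \<ge> 0\<close> \<open>1 - \<nu> * sqrt q > 0\<close> r by (simp_all add: a_def r_def)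
  have grad: "GDERIV f v :> gradient f v" for v
    using \<open>f \<in> smooth_strongly_convex \<mu> L\<close>
    by (intro GDERIV_gradient) (simp add: smooth_strongly_convex_def)
  have lip: "norm (gradient f v - gradient f u) \<le> L * norm (v - u)" for u v
    using \<open>f \<in> smooth_strongly_convex \<mu> L\<close> by (simp add: smooth_strongly_convex_def)
  have strong: "f v \<ge> f u + gradient f u \<bullet> (v - u) + \<mu> / 2 * (norm (v - u))\<^sup>2" for u v
    using \<open>f \<in> smooth_strongly_convex \<mu> L\<close> by (simp add: smooth_strongly_convex_def)
  have convex: "f v \<ge> f u + gradient f u \<bullet> (v - u)" for u v
  proof -
    have "0 \<le> \<mu> / 2 * (norm (v - u))\<^sup>2" using \<open>0 < \<mu>\<close> by simp
    then show ?thesis using strong[of u v] by linarith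
  qed
  have k: "k = Suc (k - 1)" using \<open>k \<ge> 1\<close> by simp
  have z_step: "z (k + 1) = a *\<^sub>R (x k - (1 / \<mu>) *\<^sub>R g) + (1 - a) *\<^sub>R z k"
    and y_step: "y k = x (k - 1) - (\<eta> * s) *\<^sub>R p"
    and x_step: "x k = (\<tau> * r / (1 + r)) *\<^sub>R z k + (1 - \<tau> * r / (1 + r)) *\<^sub>R y k"
    using \<open>algorithm_A \<mu> s q \<eta> \<nu> \<tau> f x y z\<close> k
    unfolding algorithm_A_def a_def r_def g_def p_def Suc_eq_plus1[symmetric] by metis+
  have "\<tau> * r / (1 + r) \<noteq> 0" using \<open>\<tau> > 0\<close> r by simp
  moreover have "(1 - \<tau> * r / (1 + r)) / (\<tau> * r / (1 + r)) = c"
  proof -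
    have "1 - \<tau> * r / (1 + r) = \<zeta> / (1 + r)"
      using r(1) by (simp add: \<zeta>_def r_def[symmetric] field_simps)
    then show ?thesis using r(1) by (simp add: c_def)
  qed
  ultimately have xz: "x k - z k = c *\<^sub>R d"
    using affine_combination_diff[OF _ x_step] by (simp add: d_def)
  have momentum: "1 / (1 - a) * (\<mu> / 2) * (norm (z (k + 1) - xstar))\<^sup>2 + a / (1 - a) * (f (x k) - fstar)
      \<le> \<mu> / 2 * (norm (z k - xstar))\<^sup>2 + a\<^sup>2 / (1 - a) * ((norm g)\<^sup>2 / (2 * \<mu>))
        + a * (g \<bullet> (x k - z k)) - a * (\<mu> / 2) * (norm (x k - z k))\<^sup>2"
    using momentum_step_bound[OF \<open>0 < \<mu>\<close> a strong z_step[unfolded g_def]]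
    unfolding g_def fstar_def .
  have "f (x k) - f (x (k - 1)) + \<eta> * s / 2 * (norm p)\<^sup>2 \<le> - (g \<bullet> d) - \<eta> * s / 2 * (norm g)\<^sup>2"
    using gradient_step_bound[OF \<open>\<eta> * s \<le> 1 / L\<close> L
        smooth_convex_interpolation[OF L grad lip convex] y_step[unfolded p_def]]
    unfolding g_def p_def d_def .
  moreover have "0 \<le> C"
    using \<open>\<zeta> \<ge> 0\<close> \<open>\<nu> \<ge> 0\<close> \<open>\<tau> > 0\<close> \<eta> r by (simp add: C_def)
  ultimately have descent: "C * (f (x k) - f (x (k - 1)) + \<eta> * s / 2 * (norm p)\<^sup>2)
      \<le> C * (- (g \<bullet> d) - \<eta> * s / 2 * (norm g)\<^sup>2)"
    by (rule mult_left_mono)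
  define h where "h = \<eta> * s"
  define m where "m = \<nu> * \<zeta> / \<tau>"
  define K where "K = \<nu> * \<zeta>\<^sup>2 * r / (2 * \<tau>\<^sup>2 * s)"
  have C: "C = m + 2 * K * h"
    using \<open>\<tau> > 0\<close> \<open>s > 0\<close> by (simp add: C_def m_def K_def h_def field_simps power2_eq_square)
  have ac: "a * c = m"
    using r \<open>\<tau> > 0\<close> by (simp add: a_def c_def m_def)
  have "\<mu> = r\<^sup>2 / s" using r \<open>s > 0\<close> by simp
  then have ac2: "a * (\<mu> / 2) * c\<^sup>2 = K"
    using r(1) \<open>\<tau> > 0\<close> \<open>s > 0\<close> by (simp add: a_def c_def K_def power2_eq_square ac_simps)
  have slack: "C * (- (g \<bullet> d) - \<eta> * s / 2 * (norm g)\<^sup>2) + m * h / 2 * (norm g)\<^sup>2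
      + a * (g \<bullet> (x k - z k)) - a * (\<mu> / 2) * (norm (x k - z k))\<^sup>2
      = - (K * (norm (d + h *\<^sub>R g))\<^sup>2)"
  proof -
    have "a * (g \<bullet> (x k - z k)) = m * (g \<bullet> d)"
      unfolding xz ac[symmetric] by simp
    moreover have "a * (\<mu> / 2) * (norm (x k - z k))\<^sup>2 = K * (d \<bullet> d)"
      unfolding xz ac2[symmetric] by (simp add: power_mult_distrib power2_norm_eq_inner)
    moreover have "(norm (d + h *\<^sub>R g))\<^sup>2 = d \<bullet> d + 2 * h * (g \<bullet> d) + h\<^sup>2 * (g \<bullet> g)"
      unfolding power2_norm_eq_inner
      by (simp add: inner_simps inner_commute power2_eq_square algebra_simps)
    ultimately show ?thesis
      unfolding C h_def[symmetric] power2_norm_eq_inner[of g]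
      by (simp only:) (simp add: algebra_simps power2_eq_square)
  qed
  have "0 \<le> K * (norm (d + h *\<^sub>R g))\<^sup>2"
    using \<open>\<nu> \<ge> 0\<close> r \<open>s > 0\<close> by (simp add: K_def)
  with descent slack have "C * (f (x k) - f (x (k - 1)) + \<eta> * s / 2 * (norm p)\<^sup>2) + m * h / 2 * (norm g)\<^sup>2
      + a * (g \<bullet> (x k - z k)) - a * (\<mu> / 2) * (norm (x k - z k))\<^sup>2 \<le> 0"
    by linarith
  moreover have mh: "m * h / 2 = \<nu> * s / 2 * (\<zeta> * \<eta> / \<tau>)"
    by (simp add: m_def h_def ac_simps)
  ultimately have rest: "C * (f (x k) - fstar) + \<nu> * s / 2 * (\<zeta> * \<eta> / \<tau>) * (norm g)\<^sup>2
      + a * (g \<bullet> (x k - z k)) - a * (\<mu> / 2) * (norm (x k - z k))\<^sup>2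
      \<le> C * (f (x (k - 1)) - fstar - \<eta> * s / 2 * (norm p)\<^sup>2)"
    unfolding mh[symmetric] distrib_left right_diff_distrib by linarith
  have "a\<^sup>2 = \<nu>\<^sup>2 * (\<mu> * s)"
    unfolding a_def power_mult_distrib r(2) ..
  then have "a\<^sup>2 / (1 - a) * ((norm g)\<^sup>2 / (2 * \<mu>)) = \<nu> * s / 2 * (\<nu> / (1 - a)) * (norm g)\<^sup>2"
    using \<open>0 < \<mu>\<close> by (simp add: power2_eq_square ac_simps)
  with momentum rest have "(C + a / (1 - a)) * (f (x k) - fstar)
      - \<nu> * s / 2 * (\<nu> / (1 - a) - \<zeta> * \<eta> / \<tau>) * (norm g)\<^sup>2
      + 1 / (1 - a) * (\<mu> / 2) * (norm (z (k + 1) - xstar))\<^sup>2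
      \<le> C * (f (x (k - 1)) - fstar - \<eta> * s / 2 * (norm p)\<^sup>2) + \<mu> / 2 * (norm (z k - xstar))\<^sup>2"
    unfolding distrib_right left_diff_distrib right_diff_distrib by linarith
  then show ?thesis
    unfolding C_def a_def r_def g_def p_def .
qed

end
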